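(* For all integers $n \geq 1$ and all real $x$, $$c_n(x) = c_n + (-1)^n n \sum_{m=1}^n \frac{1}{m} \genfrac{[}{]}{0pt}{}{n-1}{m-1} x^m$$ and $$\widehat{c}_n(x) = c_n + (-1)^n n \sum_{m=1}^n \frac{(-1)^{m}}{m} \genfrac{[}{]}{0pt}{}{n-1}{m-1}(x-1)^m,$$ where the Cauchy numbers of the first kind $c_n$ can be expressed in terms of Bernoulli numbers as $$c_n = \delta_{n,1} + (-1)^{n+1} n \sum_{m=1}^n \genfrac{[}{]}{0pt}{}{n-1}{m-1} \frac{B_m}{m}, \qquad n \geq 1.$$
   Context: For real $z$ and integer $n\ge 0$, $\binom{z}{n} = \frac{z(z-1)\cdots(z-n+1)}{n!}$. The Cauchy polynomials of the first and second kind are $c_n(x) = n! \int_{0}^{1} \binom{t - x}{n}\, dt$ and $\widehat{c}_n(x) = n! \int_{0}^{1} \binom{x - t}{n}\, dt$, $n \ge 0$; the Cauchy numbers of the first kind are $c_n = c_n(0)$. $\genfrac{[}{]}{0pt}{}{n}{m}$ are the unsigned Stirling numbers of the first kind. $B_m$ are the Bernoulli numbers defined by $\frac{t}{e^t-1}=\sum_{m\ge0} B_m \frac{t^m}{m!}$ (so $B_1=-\tfrac12$). $\delta_{n,1}$ is the Kronecker delta. *)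

theory Defs
  imports
    "HOL-Analysis.Analysis"
    "HOL-Computational_Algebra.Formal_Power_Series"
    "HOL-Combinatorics.Stirling"
begin

definition cauchy_poly1 :: "nat \<Rightarrow> real \<Rightarrow> real" where
  "cauchy_poly1 n x = fact n * integral {0..1} (\<lambda>t. (t - x) gchoose n)"

definition cauchy_poly2 :: "nat \<Rightarrow> real \<Rightarrow> real" where
  "cauchy_poly2 n x = fact n * integral {0..1} (\<lambda>t. (x - t) gchoose n)"

definition cauchy_num1 :: "nat \<Rightarrow> real" where
  "cauchy_num1 n = cauchy_poly1 n 0"

(* Numerator and denominator both vanish to first order at 0, so the quotient of formal
   power series is exact; in this convention bernoulli 1 = -1/2. *)
definition bernoulli :: "nat \<Rightarrow> real" where
  "bernoulli m = fact m * fps_nth (fps_X / (fps_exp 1 - 1)) m"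

lemma bernoulli_generating_function:
  "Abs_fps (\<lambda>m. bernoulli m / fact m) * (fps_exp 1 - 1) = fps_X"
proof -
  let ?g = "fps_exp 1 - 1 :: real fps"
  have "subdegree ?g = 1"
    by (rule subdegreeI) auto
  hence "?g dvd fps_X"
    by (subst fps_dvd_iff) auto
  moreover have "Abs_fps (\<lambda>m. bernoulli m / fact m) = fps_X / ?g"
    by (rule fps_ext) (simp add: bernoulli_def)
  ultimately show ?thesis
    by simp
qed

lemma gchoose_integrable_on:
  fixes x :: real
  shows "(\<lambda>t. (t - x) gchoose n) integrable_on {0..1}"
    and "(\<lambda>t. (x - t) gchoose n) integrable_on {0..1}"
  by (auto simp: gbinomial_prod_rev intro!: integrable_continuous_real continuous_intros)

end

(*
  The integral defining c_n(x) is K(x) - K(x + 1) for a polynomial K with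
  K'(x) = -n! binom(1 - x, n).  Differentiating this difference gives a multiple of a
  rising factorial, whose coefficients are Stirling numbers; hence the first formula.
  The second one follows from the first by t -> 1 - t, which turns the second kind at x into
  the first kind at 1 - x.
  For the third, let L be the linear functional on polynomials with L(x^m) = B_m.  The
  generating function of the Bernoulli numbers says L(p(x + 1)) - L(p) = p'(0), so applying L
  to c_n(x) = K(x) - K(x + 1) gives -K'(0) = n! binom(1, n).
*)
theory Submission
  imports Defs
begin

lemma bernoulli_0 [simp]: "bernoulli 0 = 1"
proof -
  have "fps_nth (Abs_fps (\<lambda>m. bernoulli m / fact m) * (fps_exp 1 - 1)) 1 = 1"
    by (simp only: bernoulli_generating_function) simp
  then show ?thesis
    by (simp add: fps_mult_nth)
qed

text \<open>Coefficient comparison, scaled by m!, in b(t) * exp(t) = b(t) + t, a rearrangement of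
  the generating function identity. The term k = m stays in the sum, so B_m reappears on the
  right.\<close>

lemma sum_binomial_bernoulli:
  "(\<Sum>k\<le>m. real (m choose k) * bernoulli k) = bernoulli m + (if m = 1 then 1 else 0)"
proof -
  let ?b = "Abs_fps (\<lambda>m. bernoulli m / fact m)"
  have "?b * fps_exp 1 = ?b + fps_X"
    using bernoulli_generating_function by (simp add: algebra_simps)
  then have "fact m * fps_nth (?b * fps_exp 1) m = fact m * fps_nth (?b + fps_X) m"
    by simp
  also have "fact m * fps_nth (?b * fps_exp 1) m = (\<Sum>k\<le>m. real (m choose k) * bernoulli k)"
    unfolding fps_mult_nth sum_distrib_left atLeast0AtMost
    by (intro sum.cong) (auto simp: binomial_fact field_simps)
  finally show ?thesis
    by (auto simp: field_simps)
qed

definition bernoulli_functional :: "real poly \<Rightarrow> real" where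
  "bernoulli_functional p = (\<Sum>i\<le>degree p. coeff p i * bernoulli i)"

text \<open>Polynomials of different degrees have to be summed over one common range before
  linearity can be read off termwise.\<close>

lemma bernoulli_functional_bound:
  assumes "degree p \<le> N"
  shows "bernoulli_functional p = (\<Sum>i\<le>N. coeff p i * bernoulli i)"
  unfolding bernoulli_functional_def using assms
  by (intro sum.mono_neutral_left) (auto simp: coeff_eq_0)

lemma bernoulli_functional_add:
  "bernoulli_functional (p + q) = bernoulli_functional p + bernoulli_functional q"
proof -
  let ?N = "max (degree p) (degree q)"
  show ?thesis
    by (simp add: bernoulli_functional_bound[of _ ?N] degree_add_le
        sum.distrib algebra_simps)
qed

lemma bernoulli_functional_smult:
  "bernoulli_functional (smult c p) = c * bernoulli_functional p"
  by (simp add: bernoulli_functional_bound[of _ "degree p"] degree_smult_le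
      sum_distrib_left algebra_simps)

lemma bernoulli_functional_diff:
  "bernoulli_functional (p - q) = bernoulli_functional p - bernoulli_functional q"
  using bernoulli_functional_add[of "p - q" q] by simp

lemma bernoulli_functional_0 [simp]: "bernoulli_functional 0 = 0"
  by (simp add: bernoulli_functional_def)

lemma bernoulli_functional_sum:
  "bernoulli_functional (\<Sum>i\<in>A. f i) = (\<Sum>i\<in>A. bernoulli_functional (f i))"
  by (induction A rule: infinite_finite_induct) (auto simp: bernoulli_functional_add)

lemma bernoulli_functional_monom [simp]:
  "bernoulli_functional (monom c m) = c * bernoulli m"
  by (simp add: bernoulli_functional_bound[of _ m] degree_monom_le if_distrib[of "\<lambda>x. x * _"]
      cong: if_cong)

lemma bernoulli_functional_const [simp]: "bernoulli_functional [:c:] = c"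
  by (simp add: bernoulli_functional_def)

text \<open>Expanding (x + 1)^m binomially turns the left side into the sum of
  \<open>sum_binomial_bernoulli\<close>. The correction at m = 1 is the derivative of the monomial
  at 0, written as a coefficient so that it extends linearly.\<close>

lemma bernoulli_functional_shift_monom:
  "bernoulli_functional (pcompose (monom c m) [:1, 1:]) =
     bernoulli_functional (monom c m) + coeff (monom c m) 1"
proof -
  have "pcompose (monom c m) [:1, 1:] = smult c ([:1, 1:] ^ m)"
    by (rule poly_ext) (simp add: poly_pcompose poly_monom)
  moreover have "bernoulli_functional ([:1, 1:] ^ m) = bernoulli m + (if m = 1 then 1 else 0)"
    unfolding sum_binomial_bernoulli[symmetric]
    by (simp add: bernoulli_functional_def degree_linear_power coeff_linear_poly_power)
  ultimately show ?thesis
    by (simp add: bernoulli_functional_smult algebra_simps)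
qed

lemma bernoulli_functional_shift:
  "bernoulli_functional (pcompose p [:1, 1:]) = bernoulli_functional p + coeff p 1"
proof -
  have p: "p = (\<Sum>i\<le>degree p. monom (coeff p i) i)"
    by (rule poly_as_sum_of_monoms[symmetric])
  show ?thesis
    by (subst (1 2 3) p)
      (simp only: pcompose_sum bernoulli_functional_sum bernoulli_functional_shift_monom
        sum.distrib coeff_sum)
qed

lemma pderiv_sum: "pderiv (\<Sum>i\<in>A. f i) = (\<Sum>i\<in>A. pderiv (f i))"
  using higher_pderiv_sum[where n = 1] by simp

lemma exists_poly_antiderivative:
  fixes p :: "'a::field_char_0 poly"
  obtains q where "pderiv q = p"
proof
  let ?q = "\<Sum>i\<le>degree p. monom (coeff p i / of_nat (Suc i)) (Suc i)"
  have "pderiv ?q = (\<Sum>i\<le>degree p. monom (coeff p i) i)"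
    by (simp add: pderiv_sum pderiv_monom del: of_nat_Suc)
  then show "pderiv ?q = p"
    by (simp add: poly_as_sum_of_monoms)
qed

lemma poly_pochhammer: "poly (pochhammer p n) x = pochhammer (poly p x) n"
  by (simp add: pochhammer_prod poly_prod)

lemma cauchy_poly2_eq: "cauchy_poly2 n x = cauchy_poly1 n (1 - x)"
proof -
  \<comment> \<open>The substitution t -> 1 - t is split into a reflection onto [-1, 0] and a shift
    by 1.\<close>
  have "integral {0..1} (\<lambda>t. (x - t) gchoose n) =
        integral {-1..-0} (\<lambda>t. (x - (- t)) gchoose n)"
    by (rule Henstock_Kurzweil_Integration.integral_reflect_real[symmetric])
  also have "\<dots> = integral {0..1} (\<lambda>t. (t - (1 - x)) gchoose n)"
    using integral_shift_real_ivl[of 0 1 1 "\<lambda>t. (t - (1 - x)) gchoose n"]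
    by (simp add: add.commute)
  finally show ?thesis
    by (simp add: cauchy_poly1_def cauchy_poly2_def)
qed

text \<open>As n! binom(u, n) = (-1)^n \<open>pochhammer (-u) n\<close>, the assumption says K'(1 -
  u) = -n! binom(u, n). So t -> K(1 - (t - x)) is an antiderivative of the integrand, with values
  K(x) at t = 1 and K(x + 1) at t = 0.\<close>

lemma cauchy_poly1_eq_poly:
  fixes K :: "real poly"
  assumes K: "pderiv K = - smult ((-1) ^ n) (pochhammer [:-1, 1:] n)"
  shows "cauchy_poly1 n x = poly (K - pcompose K [:1, 1:]) x"
proof -
  have deriv: "poly (pderiv K) (1 - u) = - (fact n * (u gchoose n))" for u
    by (simp add: K poly_pochhammer gbinomial_pochhammer)
  have "((\<lambda>t. fact n * ((t - x) gchoose n)) has_integral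
          poly K (1 - (1 - x)) - poly K (1 - (0 - x))) {0..1}"
    using deriv[of "t - x" for t]
    by (intro fundamental_theorem_of_calculus)
      (auto simp flip: has_real_derivative_iff_has_vector_derivative
        intro!: derivative_eq_intros)
  then show ?thesis
    by (auto simp: cauchy_poly1_def poly_pcompose add.commute dest!: integral_unique)
qed

text \<open>Both products share the factor \<open>pochhammer x k\<close>; the remaining factors x +
  k and x - 1 differ by k + 1.\<close>

lemma pochhammer_diff_shift:
  fixes x :: "'a::comm_ring_1"
  shows "pochhammer x (Suc k) - pochhammer (x - 1) (Suc k) = of_nat (Suc k) * pochhammer x k"
  by (subst pochhammer_rec[of "x - 1"]) (simp add: pochhammer_Suc algebra_simps)

lemma stirling_sum_eq_pochhammer:
  fixes x :: real
  assumes "n \<ge> 1"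
  shows "(\<Sum>m=1..n. real (stirling (n - 1) (m - 1)) * x ^ (m - 1)) = pochhammer x (n - 1)"
proof -
  from assms obtain k where n: "n = Suc k"
    by (cases n) auto
  show ?thesis
    by (simp add: n sum.atLeast1_atMost_eq lessThan_Suc_atMost stirling_pochhammer del: sum.cl_ivl_Suc)
qed

lemma poly_eqI_pderiv:
  fixes p q :: "'a::field_char_0 poly"
  assumes "pderiv p = pderiv q" "poly p 0 = poly q 0"
  shows "p = q"
proof -
  from assms have "pderiv (p - q) = 0"
    by (simp add: pderiv_diff)
  then obtain c where "p - q = [:c:]"
    using pderiv_iszero by blast
  moreover from this assms(2) have "c = 0"
    by (metis poly_diff poly_pCons diff_self mult_zero_left add_0_right)
  ultimately show ?thesis
    by simp
qed

theorem theorem1: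
  fixes n :: nat and x :: real
  assumes "n \<ge> 1"
  shows "cauchy_poly1 n x =
           cauchy_num1 n
           + (-1) ^ n * real n * (\<Sum>m=1..n. 1 / real m * real (stirling (n - 1) (m - 1)) * x ^ m)
    \<and> cauchy_poly2 n x =
           cauchy_num1 n
           + (-1) ^ n * real n *
               (\<Sum>m=1..n. (-1) ^ m / real m * real (stirling (n - 1) (m - 1)) * (x - 1) ^ m)
    \<and> cauchy_num1 n =
           (if n = 1 then 1 else 0)
           + (-1) ^ (n + 1) * real n *
               (\<Sum>m=1..n. real (stirling (n - 1) (m - 1)) * (bernoulli m / real m))"
proof -
  from assms obtain k where n: "n = Suc k"
    by (cases n) auto
  obtain K :: "real poly" where K: "pderiv K = - smult ((-1) ^ n) (pochhammer [:-1, 1:] n)"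
    using exists_poly_antiderivative by blast
  define C where "C = K - pcompose K [:1, 1:]"
  \<comment> \<open>The antiderivative, vanishing at 0, of the rising factorial with n - 1
    factors.\<close>
  define S where "S = (\<Sum>m=1..n. monom (real (stirling (n - 1) (m - 1)) / real m) m)"
  have C: "cauchy_poly1 n y = poly C y" for y
    unfolding C_def by (rule cauchy_poly1_eq_poly[OF K])
  have "pderiv C = smult ((-1) ^ n * real n) (pderiv S)"
  proof (rule poly_ext)
    fix y :: real
    have "poly (pderiv C) y = (-1) ^ n * (pochhammer y n - pochhammer (y - 1) n)"
      by (simp add: C_def pderiv_diff pderiv_pcompose poly_pcompose K poly_pochhammer
          pderiv_pCons algebra_simps)
    also have "\<dots> = (-1) ^ n * real n * pochhammer y (n - 1)"
      by (simp add: n pochhammer_diff_shift del: of_nat_Suc power_Suc)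
    also have "pochhammer y (n - 1) = poly (pderiv S) y"
      unfolding stirling_sum_eq_pochhammer[OF assms, symmetric] S_def
      by (auto simp: pderiv_sum pderiv_monom poly_sum poly_monom intro!: sum.cong)
    finally show "poly (pderiv C) y = poly (smult ((-1) ^ n * real n) (pderiv S)) y"
      by simp
  qed
  moreover have "poly S 0 = 0"
    by (auto simp: S_def poly_sum poly_monom intro!: sum.neutral)
  ultimately have "pderiv C = pderiv ([:cauchy_num1 n:] + smult ((-1) ^ n * real n) S)"
    and "poly C 0 = poly ([:cauchy_num1 n:] + smult ((-1) ^ n * real n) S) 0"
    by (simp_all add: pderiv_add pderiv_smult pderiv_pCons cauchy_num1_def C)
  \<comment> \<open>An identity of polynomials, not only of values, so that the Bernoulli functional
    can be applied to both sides.\<close>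
  then have CS: "C = [:cauchy_num1 n:] + smult ((-1) ^ n * real n) S"
    by (rule poly_eqI_pderiv)
  have first: "cauchy_poly1 n y = cauchy_num1 n
           + (-1) ^ n * real n * (\<Sum>m=1..n. 1 / real m * real (stirling (n - 1) (m - 1)) * y ^ m)"
    for y
    by (simp add: C CS S_def poly_sum poly_monom)
  have "(1 - x) ^ m = (-1) ^ m * (x - 1) ^ m" for m
    by (simp flip: power_mult_distrib)
  then have second: "cauchy_poly2 n x = cauchy_num1 n + (-1) ^ n * real n *
               (\<Sum>m=1..n. (-1) ^ m / real m * real (stirling (n - 1) (m - 1)) * (x - 1) ^ m)"
    unfolding cauchy_poly2_eq first by (simp add: mult_ac)
  have "bernoulli_functional C = - coeff K 1"
    by (simp add: C_def bernoulli_functional_diff bernoulli_functional_shift)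
  also have "\<dots> = - poly (pderiv K) 0"
    by (simp add: poly_0_coeff_0 coeff_pderiv)
  also have "\<dots> = (-1) ^ n * pochhammer (-1) n"
    by (simp add: K poly_pochhammer)
  \<comment> \<open>The product (-1) * 0 * 1 * ... contains the factor 0 as soon as n \<ge> 2; for n
    = 1 it is -1.\<close>
  also have "\<dots> = (if n = 1 then 1 else 0)"
    by (cases k) (auto simp: n pochhammer_rec)
  \<comment> \<open>The functional is now evaluated on the explicit form of \<open>C\<close>: the
    constant contributes c_n, and each x^m in \<open>S\<close> becomes B_m.\<close>
  finally have "cauchy_num1 n + (-1) ^ n * real n *
       (\<Sum>m=1..n. real (stirling (n - 1) (m - 1)) * (bernoulli m / real m)) =
       (if n = 1 then 1 else 0)"
    by (simp add: CS S_def bernoulli_functional_add bernoulli_functional_smult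
        bernoulli_functional_sum)
  then have third: "cauchy_num1 n = (if n = 1 then 1 else 0) + (-1) ^ (n + 1) * real n *
       (\<Sum>m=1..n. real (stirling (n - 1) (m - 1)) * (bernoulli m / real m))"
    by simp
  show ?thesis
    using first second third by blast
qed

end
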